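(* Let $D$ be the derivation on Laurent polynomials in the commuting variables $a,x,z,v,u$ determined by the grammar $$a\to axv,\quad x\to xvz,\quad z\to vz^2,\quad v\to uv^2z,\quad u\to u^2vz$$ (extended by linearity and the Leibniz rule to Laurent polynomials / rational functions in these variables). Then for every $n\ge2$, $$D^{n-2}(av)=\frac{u-1}{xu}D^{n-1}(a)+\frac{v}{u}\Big(1+(n-2)\frac{z}{x}\Big)D^{n-2}(a).$$ *)

theory Defs
  imports "HOL-Library.Poly_Mapping"
begin

datatype gvar = A | X | Z | V | U

text \<open>
  The Laurent polynomial ring over \<open>'k\<close> in the five commuting variables is the group ring
  of the free abelian group of exponent vectors \<open>gvar \<Rightarrow>\<^sub>0 int\<close>; the library's
  multiplication on finitely supported maps is convolution.
\<close>

type_synonym 'k laurent = "(gvar \<Rightarrow>\<^sub>0 int) \<Rightarrow>\<^sub>0 'k"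

definition Const :: "'k::comm_ring_1 \<Rightarrow> 'k laurent" where
  "Const c = Poly_Mapping.single 0 c"

definition Gen :: "gvar \<Rightarrow> 'k::comm_ring_1 laurent" where
  "Gen i = Poly_Mapping.single (Poly_Mapping.single i 1) 1"

definition Gen_inv :: "gvar \<Rightarrow> 'k::comm_ring_1 laurent" where
  "Gen_inv i = Poly_Mapping.single (Poly_Mapping.single i (- 1)) 1"

lemma Gen_mult_Gen_inv: "Gen i * Gen_inv i = (1 :: 'k::comm_ring_1 laurent)"
  by (simp add: Gen_def Gen_inv_def mult_single flip: single_add)

definition derivation :: "('k::comm_ring_1 laurent \<Rightarrow> 'k laurent) \<Rightarrow> bool" where
  "derivation E \<longleftrightarrow>
     (\<forall>p q. E (p + q) = E p + E q) \<and>
     (\<forall>c p. E (Const c * p) = Const c * E p) \<and>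
     (\<forall>p q. E (p * q) = E p * q + p * E q)"

definition grammar_derivation ::
  "(gvar \<Rightarrow> 'k::comm_ring_1 laurent) \<Rightarrow> 'k laurent \<Rightarrow> 'k laurent" where
  "grammar_derivation w = (THE E. derivation E \<and> (\<forall>i. E (Gen i) = w i))"

fun grammar :: "gvar \<Rightarrow> 'k::comm_ring_1 laurent" where
  "grammar A = Gen A * Gen X * Gen V"
| "grammar X = Gen X * Gen V * Gen Z"
| "grammar Z = Gen V * Gen Z ^ 2"
| "grammar V = Gen U * Gen V ^ 2 * Gen Z"
| "grammar U = Gen U ^ 2 * Gen V * Gen Z"

definition D :: "'k::comm_ring_1 laurent \<Rightarrow> 'k laurent" where
  "D = grammar_derivation grammar"

text \<open>
  The remainder shows that the definite description in \<open>grammar_derivation\<close> is well posed: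
  every assignment of Laurent polynomials to the variables extends to exactly one derivation.
\<close>

lemma poly_mapping_add_single_induct [case_names zero add]:
  fixes p :: "'a \<Rightarrow>\<^sub>0 'b::ab_group_add"
  assumes "P 0" and "\<And>p k c. P p \<Longrightarrow> P (p + Poly_Mapping.single k c)"
  shows "P p"
proof (induction "card (Poly_Mapping.keys p)" arbitrary: p)
  case 0
  then have "p = 0" by (simp add: keys_eq_empty)
  with assms(1) show ?case by simp
next
  case (Suc n)
  then obtain k where k: "k \<in> Poly_Mapping.keys p"
    by (metis card.empty equals0I nat.distinct(1))
  let ?q = "p - Poly_Mapping.single k (Poly_Mapping.lookup p k)"
  have "Poly_Mapping.keys ?q = Poly_Mapping.keys p - {k}"
    by (auto simp: in_keys_iff lookup_minus lookup_single when_def split: if_splits)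
  with Suc(2) k have "n = card (Poly_Mapping.keys ?q)" by simp
  from assms(2)[OF Suc(1)[OF this], of k "Poly_Mapping.lookup p k"] show ?case by simp
qed

text \<open>Existence: on a monomial, the derivation multiplies by the logarithmic derivative.\<close>

definition log_deriv :: "(gvar \<Rightarrow> 'k::comm_ring_1 laurent) \<Rightarrow> (gvar \<Rightarrow>\<^sub>0 int) \<Rightarrow> 'k laurent" where
  "log_deriv w m = (\<Sum>i\<in>{A, X, Z, V, U}. of_int (Poly_Mapping.lookup m i) * (w i * Gen_inv i))"

definition deriv_ext :: "(gvar \<Rightarrow> 'k::comm_ring_1 laurent) \<Rightarrow> 'k laurent \<Rightarrow> 'k laurent" where
  "deriv_ext w p =
     (\<Sum>m\<in>Poly_Mapping.keys p. Poly_Mapping.single m (Poly_Mapping.lookup p m) * log_deriv w m)"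

lemma log_deriv_add: "log_deriv w (m + m') = log_deriv w m + log_deriv w m'"
  by (simp add: log_deriv_def lookup_add algebra_simps)

lemma log_deriv_zero: "log_deriv w 0 = 0"
  by (simp add: log_deriv_def)

lemma log_deriv_single: "log_deriv w (Poly_Mapping.single i 1) = w i * Gen_inv i"
  by (cases i) (simp_all add: log_deriv_def lookup_single)

lemma deriv_ext_superset:
  assumes "finite S" "Poly_Mapping.keys p \<subseteq> S"
  shows "deriv_ext w p =
    (\<Sum>m\<in>S. Poly_Mapping.single m (Poly_Mapping.lookup p m) * log_deriv w m)"
  unfolding deriv_ext_def
  by (rule sum.mono_neutral_left) (use assms in \<open>auto simp: in_keys_iff\<close>)

lemma deriv_ext_single:
  "deriv_ext w (Poly_Mapping.single m c) = Poly_Mapping.single m c * log_deriv w m"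
  by (subst deriv_ext_superset[where S = "{m}"]) auto

lemma deriv_ext_add: "deriv_ext w (p + q) = deriv_ext w p + deriv_ext w q"
proof -
  let ?S = "Poly_Mapping.keys p \<union> Poly_Mapping.keys q"
  have "Poly_Mapping.keys (p + q) \<subseteq> ?S" by (rule Poly_Mapping.keys_add)
  then show ?thesis
    by (simp add: deriv_ext_superset[where S = ?S] lookup_add single_add
        distrib_right sum.distrib)
qed

lemma deriv_ext_zero: "deriv_ext w 0 = 0"
  by (simp add: deriv_ext_def)

lemma deriv_ext_mult: "deriv_ext w (p * q) = deriv_ext w p * q + p * deriv_ext w q"
proof (induction p rule: poly_mapping_add_single_induct)
  case zero
  show ?case by (simp add: deriv_ext_zero)
next
  case (add p k c)
  have single: "deriv_ext w (Poly_Mapping.single k c * q) =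
      deriv_ext w (Poly_Mapping.single k c) * q + Poly_Mapping.single k c * deriv_ext w q"
  proof (induction q rule: poly_mapping_add_single_induct)
    case zero
    show ?case by (simp add: deriv_ext_zero)
  next
    case (add q l d)
    have prod: "Poly_Mapping.single (k + l) (c * d) =
        Poly_Mapping.single k c * Poly_Mapping.single l d"
      by (simp add: mult_single)
    then have "deriv_ext w (Poly_Mapping.single k c * Poly_Mapping.single l d) =
        Poly_Mapping.single k c * Poly_Mapping.single l d * (log_deriv w k + log_deriv w l)"
      by (simp only: deriv_ext_single log_deriv_add flip: prod)
    with add show ?case
      by (simp add: deriv_ext_add deriv_ext_single algebra_simps)
  qed
  with add show ?case
    by (simp add: deriv_ext_add algebra_simps)
qed

lemma derivation_deriv_ext: "derivation (deriv_ext w)"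
proof -
  have "deriv_ext w (Const c) = 0" for c
    by (simp add: Const_def deriv_ext_single log_deriv_zero)
  then show ?thesis
    by (simp add: derivation_def deriv_ext_add deriv_ext_mult)
qed

lemma deriv_ext_Gen: "deriv_ext w (Gen i) = w i"
proof -
  have "deriv_ext w (Gen i) = Gen i * Gen_inv i * w i"
    by (simp add: Gen_def deriv_ext_single log_deriv_single ac_simps)
  then show ?thesis by (simp add: Gen_mult_Gen_inv)
qed

lemma derivation_unique:
  fixes E F :: "'k::comm_ring_1 laurent \<Rightarrow> 'k laurent"
  assumes E: "derivation E" and F: "derivation F" and eq: "\<And>i. E (Gen i) = F (Gen i)"
  shows "E = F"
proof -
  define H where "H p = E p - F p" for p
  have H_add: "H (p + q) = H p + H q" for p q
    using E F by (simp add: H_def derivation_def)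
  have scale: "H (Const c * p) = Const c * H p" for c p
  proof -
    have "E (Const c * p) = Const c * E p" "F (Const c * p) = Const c * F p"
      using E F unfolding derivation_def by blast+
    then show ?thesis by (simp only: H_def right_diff_distrib)
  qed
  have mult: "H (p * q) = H p * q + p * H q" for p q
    using E F by (simp add: H_def derivation_def algebra_simps)
  have H_zero: "H 0 = 0" using H_add[of 0 0] by simp
  have one: "H 1 = 0" using mult[of 1 1] by simp
  have gen: "H (Gen i) = 0" for i using eq by (simp add: H_def)
  have gen_inv: "H (Gen_inv i) = 0" for i
  proof -
    have "Gen i * H (Gen_inv i) = 0"
      using mult[of "Gen i" "Gen_inv i"] by (simp add: Gen_mult_Gen_inv one gen)
    then have "Gen_inv i * (Gen i * H (Gen_inv i)) = 0" by simp
    then show ?thesis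
      by (simp add: Gen_mult_Gen_inv mult.commute[of "Gen_inv i"] flip: mult.assoc)
  qed
  have pow: "H (Poly_Mapping.single (Poly_Mapping.single i k) 1) = 0" for i k
  proof (induction k rule: int_induct[where k = 0])
    case base
    then show ?case using one by simp
  next
    case (step1 k)
    have "Poly_Mapping.single (Poly_Mapping.single i (k + 1)) 1 =
        Poly_Mapping.single (Poly_Mapping.single i k) 1 * (Gen i :: 'k laurent)"
      by (simp add: Gen_def mult_single single_add)
    with step1 show ?case by (simp add: mult gen)
  next
    case (step2 k)
    have "Poly_Mapping.single (Poly_Mapping.single i (k - 1)) 1 =
        Poly_Mapping.single (Poly_Mapping.single i k) 1 * (Gen_inv i :: 'k laurent)"
      by (simp add: Gen_inv_def mult_single flip: single_add)
    with step2 show ?case by (simp add: mult gen_inv)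
  qed
  have mono: "H (Poly_Mapping.single m 1) = 0" for m
  proof (induction m rule: poly_mapping_add_single_induct)
    case zero
    then show ?case using one by simp
  next
    case (add m i k)
    have "Poly_Mapping.single (m + Poly_Mapping.single i k) 1 =
        Poly_Mapping.single m 1 * (Poly_Mapping.single (Poly_Mapping.single i k) 1 :: 'k laurent)"
      by (simp add: mult_single)
    with add show ?case by (simp add: mult pow)
  qed
  have "H p = 0" for p
  proof (induction p rule: poly_mapping_add_single_induct)
    case zero
    show ?case by (rule H_zero)
  next
    case (add p m c)
    have "Poly_Mapping.single m c = Const c * Poly_Mapping.single m 1"
      by (simp add: Const_def mult_single)
    with add show ?case by (simp add: H_add scale mono)
  qed
  then show ?thesis by (auto simp: H_def)
qed

lemma ex1_grammar_derivation:
  fixes w :: "gvar \<Rightarrow> 'k::comm_ring_1 laurent"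
  shows "\<exists>!E. derivation E \<and> (\<forall>i. E (Gen i) = w i)"
proof (rule ex1I[of _ "deriv_ext w"])
  show "derivation (deriv_ext w) \<and> (\<forall>i. deriv_ext w (Gen i) = w i)"
    by (simp add: derivation_deriv_ext deriv_ext_Gen)
next
  fix E :: "'k laurent \<Rightarrow> 'k laurent"
  assume "derivation E \<and> (\<forall>i. E (Gen i) = w i)"
  then show "E = deriv_ext w"
    by (intro derivation_unique) (simp_all add: derivation_deriv_ext deriv_ext_Gen)
qed

lemma grammar_derivation:
  shows derivation_grammar_derivation: "derivation (grammar_derivation w)"
    and grammar_derivation_Gen: "grammar_derivation w (Gen i) = w i"
  using theI'[OF ex1_grammar_derivation[of w]] by (auto simp: grammar_derivation_def)

lemma derivation_D: "derivation D"
  and D_Gen: "D (Gen i) = grammar i"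
  by (simp_all add: D_def grammar_derivation)

end

theory Submission
  imports Defs
begin

text \<open>
  Write the identity as \<open>D\<^sup>m(av) = f D\<^sup>m\<^sup>+\<^sup>1(a) + g\<^sub>m D\<^sup>m(a)\<close> with \<open>m = n - 2\<close>,
  \<open>f = (u - 1)/(xu)\<close> and \<open>g\<^sub>m = (v/u)(1 + m z/x)\<close>. Both \<open>v/u\<close> and \<open>z/x\<close> are constants of the derivation, so every \<open>g\<^sub>m\<close> is, and \<open>D f = (v/u)(z/x) = g\<^sub>m\<^sub>+\<^sub>1 - g\<^sub>m\<close>. Hence
  applying \<open>D\<close> to the identity for \<open>m\<close> gives the identity for \<open>m + 1\<close>.
\<close>

lemma D_add: "D (p + q) = D p + D q"
  and D_mult: "D (p * q) = D p * q + p * D q"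
  using derivation_D unfolding derivation_def by blast+

lemma D_zero [simp]: "D 0 = 0"
  using D_add[of 0 0] by simp

lemma D_one [simp]: "D 1 = 0"
  using D_mult[of 1 1] by simp

lemma D_diff: "D (p - q) = D p - D q"
  using D_add[of "p - q" q] by simp

lemma D_of_nat [simp]: "D (of_nat k) = 0"
  by (induction k) (simp_all add: D_add)

text \<open>Differentiate \<open>p * q = 1\<close> and multiply by \<open>q\<close>. This yields the
  derivatives of \<open>Gen_inv X\<close> and \<open>Gen_inv U\<close>.\<close>

lemma D_inverse:
  assumes "p * q = 1"
  shows "D q = - (q * q * D p)"
proof -
  have "D p * q + p * D q = 0"
    using arg_cong[OF assms, of D] by (simp add: D_mult)
  then have "p * D q = - (D p * q)"
    by (simp add: eq_neg_iff_add_eq_0 add.commute)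
  then have "q * (p * D q) = - (q * q * D p)"
    by (simp add: ac_simps)
  moreover have "q * (p * D q) = p * q * D q"
    by (simp add: ac_simps)
  ultimately show ?thesis
    by (simp add: assms)
qed

lemma D_Gen_inv_X: "D (Gen_inv X) = - (Gen V * Gen Z * Gen_inv X)"
proof -
  have "D (Gen_inv X) = - (Gen X * Gen_inv X * (Gen V * Gen Z * Gen_inv X))"
    by (simp add: D_inverse[OF Gen_mult_Gen_inv] D_Gen ac_simps)
  then show ?thesis by (simp add: Gen_mult_Gen_inv)
qed

lemma D_Gen_inv_U: "D (Gen_inv U) = - (Gen V * Gen Z)"
proof -
  have "D (Gen_inv U) = - (Gen U * Gen_inv U * (Gen U * Gen_inv U) * (Gen V * Gen Z))"
    by (simp add: D_inverse[OF Gen_mult_Gen_inv] D_Gen power2_eq_square ac_simps)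
  then show ?thesis by (simp add: Gen_mult_Gen_inv)
qed

text \<open>\<open>V\<close> and \<open>U\<close> have the same logarithmic derivative
  \<open>u v z\<close>.\<close>

lemma D_V_over_U: "D (Gen V * Gen_inv U) = 0"
proof -
  \<comment> \<open>Ring normalisation does not cancel \<open>Gen U\<close> against
    \<open>Gen_inv U\<close>, so the discrepancy is isolated as a multiple of
    \<open>Gen U * Gen_inv U - 1\<close>.\<close>
  have "D (Gen V * Gen_inv U) = (Gen U * Gen_inv U - 1) * (Gen V ^ 2 * Gen Z)"
    by (simp add: D_mult D_Gen D_Gen_inv_U power2_eq_square algebra_simps)
  then show ?thesis by (simp add: Gen_mult_Gen_inv)
qed

text \<open>\<open>Z\<close> and \<open>X\<close> have the same logarithmic derivative
  \<open>v z\<close>.\<close>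

lemma D_Z_over_X: "D (Gen Z * Gen_inv X) = 0"
  by (simp add: D_mult D_Gen D_Gen_inv_X power2_eq_square algebra_simps)

lemma D_leading_coefficient:
  "D ((Gen U - 1) * (Gen_inv X * Gen_inv U)) = Gen V * Gen_inv U * (Gen Z * Gen_inv X)"
proof -
  have "D ((Gen U - 1) * (Gen_inv X * Gen_inv U)) =
      Gen V * Gen_inv U * (Gen Z * Gen_inv X)
      + (Gen U * Gen_inv U - 1) * ((Gen U - 1) * (Gen V * Gen Z * Gen_inv X))"
    by (simp add: D_mult D_diff D_Gen D_Gen_inv_X D_Gen_inv_U power2_eq_square algebra_simps)
  then show ?thesis by (simp add: Gen_mult_Gen_inv)
qed

lemma D_power_A_V:
  "(D ^^ m) (Gen A * Gen V :: 'k::comm_ring_1 laurent) =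
    (Gen U - 1) * (Gen_inv X * Gen_inv U) * (D ^^ Suc m) (Gen A)
    + Gen V * Gen_inv U * (1 + of_nat m * (Gen Z * Gen_inv X)) * (D ^^ m) (Gen A)"
proof (induction m)
  case 0
  \<comment> \<open>As \<open>D a = a x v\<close>, the first summand is
    \<open>a v - a v / u\<close>, and the second restores \<open>a v / u\<close>.\<close>
  have "(Gen U - 1) * (Gen_inv X * Gen_inv U) * D (Gen A) + Gen V * Gen_inv U * Gen A =
      Gen U * Gen_inv U * (Gen X * Gen_inv X) * (Gen A * Gen V)
      - (Gen X * Gen_inv X - 1) * (Gen A * Gen V * Gen_inv U)"
    by (simp add: D_Gen algebra_simps)
  then show ?case by (simp add: Gen_mult_Gen_inv eq_commute)
next
  case (Suc m)
  let ?g = "\<lambda>m. Gen V * Gen_inv U * (1 + of_nat m * (Gen Z * Gen_inv X)) :: 'k laurent"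
  have g: "D (?g m) = 0"
    by (simp add: D_V_over_U D_Z_over_X D_mult[of "Gen V * Gen_inv U"]
        D_mult[of "of_nat m"] D_add)
  have step: "?g (Suc m) = ?g m + Gen V * Gen_inv U * (Gen Z * Gen_inv X)"
    by (simp add: algebra_simps)
  have "(D ^^ Suc m) (Gen A * Gen V :: 'k laurent) = D ((D ^^ m) (Gen A * Gen V))"
    by simp
  also have "\<dots> =
      (Gen U - 1) * (Gen_inv X * Gen_inv U) * (D ^^ Suc (Suc m)) (Gen A)
      + Gen V * Gen_inv U * (Gen Z * Gen_inv X) * (D ^^ Suc m) (Gen A)
      + ?g m * (D ^^ Suc m) (Gen A)"
    \<comment> \<open>The instantiated product rule splits only coefficient times iterate, leaving
      both coefficients whole for their own lemmas.\<close>
    unfolding Suc.IH D_add D_mult[of "_ * _" "(D ^^ _) _"] D_leading_coefficient g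
    by (simp add: add_ac)
  finally show ?case
    unfolding step by (simp only: distrib_right add_ac)
qed

theorem theorem4p2:
  fixes n :: nat
  assumes "n \<ge> 2"
  shows "(D ^^ (n - 2)) (Gen A * Gen V :: 'k::comm_ring_1 laurent) =
      (Gen U - 1) * (Gen_inv X * Gen_inv U) * (D ^^ (n - 1)) (Gen A)
      + Gen V * Gen_inv U * (1 + of_nat (n - 2) * (Gen Z * Gen_inv X)) * (D ^^ (n - 2)) (Gen A)"
proof -
  \<comment> \<open>The subtraction is truncated, so this needs \<open>n \<ge> 2\<close>.\<close>
  from assms have "n - 1 = Suc (n - 2)" by simp
  then show ?thesis by (simp only: D_power_A_V)
qed

end
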